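(* For the $k$-dimensional lattice there exists a $(k+1,c,d)$ covering scheme for any integer $d>0$, where $$c\le\bigl((8k^2+14k+2)d\bigr)^k.$$
   Context: The vertices of a finite $k$-dimensional lattice (grid graph, with edges between nearest neighbors) are labelled by $[n]$ (each vertex carries a qubit). For a set of vertices $A$, $\mathcal B(A,r)$ denotes the radius-$r$ neighborhood of $A$ on the lattice (including $A$). An $(\ell,c,d)$ covering scheme is a collection of subsets $S^i_j\subseteq[n]$, $1\le i\le\ell$, $1\le j\le m_i$, such that: (1) each $\mathcal B(S^i_j,d)$ has size at most $c$; (2) for every fixed $i$, the sets $\mathcal B(S^i_j,d)$, $1\le j\le m_i$, are pairwise disjoint; (3) for each $v\in[n]$ there exists some $S^i_j$ with $\mathcal B(\{v\},(2\ell-1)d)\subseteq S^i_j$. *)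

theory Defs
  imports "HOL-Library.FuncSet" "HOL-Library.Disjoint_Sets"
begin

text \<open>
  A grid with \<open>k\<close> axes; \<open>N i\<close> is the side length along axis \<open>i < k\<close>, and the side lengths
  may differ from each other.
\<close>

definition grid :: "nat \<Rightarrow> (nat \<Rightarrow> nat) \<Rightarrow> (nat \<Rightarrow> nat) set" where
  "grid k N = (\<Pi>\<^sub>E i\<in>{..<k}. {..<N i})"

definition nearest_neighbors :: "nat \<Rightarrow> (nat \<Rightarrow> nat) \<Rightarrow> (nat \<Rightarrow> nat) \<Rightarrow> bool" where
  "nearest_neighbors k x y \<longleftrightarrow>
     (\<exists>i<k. (x i = Suc (y i) \<or> y i = Suc (x i)) \<and> (\<forall>j<k. j \<noteq> i \<longrightarrow> x j = y j))"

text \<open>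
  The grid graph transported to the labels \<open>{1..n}\<close>: the vertex labelled \<open>v\<close> has
  coordinates \<open>pos v\<close>.  The edge relation is symmetric.
\<close>

definition lattice_labelling :: "nat \<Rightarrow> (nat \<Rightarrow> nat) \<Rightarrow> nat \<Rightarrow> (nat \<Rightarrow> nat \<Rightarrow> nat) \<Rightarrow> bool" where
  "lattice_labelling k N n pos \<longleftrightarrow> bij_betw pos {1..n} (grid k N)"

definition lattice_edges :: "nat \<Rightarrow> nat \<Rightarrow> (nat \<Rightarrow> nat \<Rightarrow> nat) \<Rightarrow> (nat \<times> nat) set" where
  "lattice_edges k n pos =
     {(u, v). u \<in> {1..n} \<and> v \<in> {1..n} \<and> nearest_neighbors k (pos u) (pos v)}"

text \<open>All vertices joined to some vertex of \<open>A\<close> by a walk of at most \<open>r\<close> edges.\<close>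

definition nbhd :: "('v \<times> 'v) set \<Rightarrow> 'v set \<Rightarrow> nat \<Rightarrow> 'v set" where
  "nbhd E A r = (\<Union>t\<le>r. (E ^^ t) `` A)"

text \<open>
  Disjointness is required between different indices \<open>j\<close>, not merely between different sets,
  so a nonempty set cannot be listed twice for the same \<open>i\<close>.
\<close>

definition covering_scheme ::
  "nat \<Rightarrow> (nat \<times> nat) set \<Rightarrow> nat \<Rightarrow> nat \<Rightarrow> nat \<Rightarrow> (nat \<Rightarrow> nat) \<Rightarrow> (nat \<Rightarrow> nat \<Rightarrow> nat set) \<Rightarrow> bool" where
  "covering_scheme n E l c d m S \<longleftrightarrow>
     (\<forall>i\<in>{1..l}. \<forall>j\<in>{1..m i}. S i j \<subseteq> {1..n}) \<and>
     (\<forall>i\<in>{1..l}. \<forall>j\<in>{1..m i}. card (nbhd E (S i j) d) \<le> c) \<and>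
     (\<forall>i\<in>{1..l}. disjoint_family_on (\<lambda>j. nbhd E (S i j) d) {1..m i}) \<and>
     (\<forall>v\<in>{1..n}. \<exists>i\<in>{1..l}. \<exists>j\<in>{1..m i}. nbhd E {v} ((2 * l - 1) * d) \<subseteq> S i j)"

end

theory Submission imports Defs begin

text \<open>
  Put \<open>w = (4k + 4)d\<close> and \<open>P = (k + 1)w\<close>.  For each of the \<open>k + 1\<close> colours \<open>i\<close>, cut the grid into
  cubes of side \<open>P\<close>, shifted by \<open>iw\<close> along every axis.  A coordinate is within \<open>(2k + 2)d\<close> of a
  cut of colour \<open>i\<close> only if it lies in a window of length \<open>w\<close> around that cut, and the windows of
  the \<open>k + 1\<close> colours are pairwise disjoint.  Hence each of the \<open>k\<close> coordinates of a vertex rules out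
  at most one colour, so for some colour the ball of radius \<open>(2k + 2)d\<close> around the vertex stays
  inside a single cube.  The sets of the scheme are the cubes shrunk by \<open>d\<close>.
\<close>

lemma mem_nbhd_singleton: "u \<in> nbhd E {v} r \<longleftrightarrow> (\<exists>t\<le>r. (v, u) \<in> E ^^ t)"
  by (auto simp: nbhd_def)

lemma nbhd_eq_UN_singleton: "nbhd E A r = (\<Union>v\<in>A. nbhd E {v} r)"
  by (auto simp: nbhd_def)

lemma nbhd_trans:
  assumes "u \<in> nbhd E {v} r" "x \<in> nbhd E {u} s"
  shows "x \<in> nbhd E {v} (r + s)"
proof -
  obtain t t' where "t \<le> r" "t' \<le> s" "(v, u) \<in> E ^^ t" "(u, x) \<in> E ^^ t'"
    using assms by (auto simp: mem_nbhd_singleton)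
  then have "t + t' \<le> r + s" "(v, x) \<in> E ^^ (t + t')"
    by (auto simp: relpow_add)
  then show ?thesis
    unfolding mem_nbhd_singleton by blast
qed

lemma nbhd_singleton_subset:
  assumes "v \<in> V" "E \<subseteq> V \<times> V"
  shows "nbhd E {v} r \<subseteq> V"
proof
  fix u assume "u \<in> nbhd E {v} r"
  then obtain t where "(v, u) \<in> E ^^ t"
    by (auto simp: mem_nbhd_singleton)
  then show "u \<in> V"
    using assms by (cases t) auto
qed

text \<open>The fibres of \<open>f i\<close> partition the vertices into cells. A cell shrunk by
  \<open>d\<close> has its \<open>d\<close>-neighborhood back inside the cell, which gives the size
  bound and disjointness; of the padding \<open>2 * l * d\<close>, the shrinking uses up
  \<open>d\<close> and leaves exactly the radius to be covered.\<close>

lemma covering_scheme_of_padded_partitions: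
  fixes f :: "nat \<Rightarrow> nat \<Rightarrow> 'a"
  assumes E: "E \<subseteq> {1..n} \<times> {1..n}"
    and cells: "\<And>i a. i \<in> {1..l} \<Longrightarrow> card {v \<in> {1..n}. f i v = a} \<le> c"
    and padded: "\<And>v. v \<in> {1..n} \<Longrightarrow>
      \<exists>i\<in>{1..l}. \<forall>u\<in>nbhd E {v} (2 * l * d). f i u = f i v"
  shows "\<exists>m S. covering_scheme n E l c d m S"
proof -
  \<comment> \<open>One index per nonempty cell: enumerating the values of \<open>f i\<close>
    without repetition makes different indices name disjoint cells.\<close>
  define m where "m i = card (f i ` {1..n})" for i
  have "\<exists>h. bij_betw h {1..m i} (f i ` {1..n})" for i
    unfolding m_def by (rule ex_bij_betw_nat_finite_1) simp
  then obtain h where h: "\<And>i. bij_betw (h i) {1..m i} (f i ` {1..n})"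
    by metis
  define cell where "cell i j = {v \<in> {1..n}. f i v = h i j}" for i j
  define S where "S i j = {v \<in> {1..n}. nbhd E {v} d \<subseteq> cell i j}" for i j
  have nbhd_S: "nbhd E (S i j) d \<subseteq> cell i j" for i j
    by (subst nbhd_eq_UN_singleton) (auto simp: S_def)
  have card_S: "card (nbhd E (S i j) d) \<le> c" if "i \<in> {1..l}" for i j
  proof -
    have "card (nbhd E (S i j) d) \<le> card (cell i j)"
      by (rule card_mono[OF _ nbhd_S]) (simp add: cell_def)
    also have "\<dots> \<le> c"
      unfolding cell_def using cells[OF that] .
    finally show ?thesis .
  qed
  have disj: "disjoint_family_on (\<lambda>j. nbhd E (S i j) d) {1..m i}" for i
    unfolding disjoint_family_on_def
  proof (intro ballI impI)
    fix j j' assume j: "j \<in> {1..m i}" "j' \<in> {1..m i}" "j \<noteq> j'"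
    then have "h i j \<noteq> h i j'"
      using inj_on_eq_iff[OF bij_betw_imp_inj_on[OF h]] by blast
    then have "cell i j \<inter> cell i j' = {}"
      by (auto simp: cell_def)
    then show "nbhd E (S i j) d \<inter> nbhd E (S i j') d = {}"
      using nbhd_S[of i j] nbhd_S[of i j'] by blast
  qed
  have cover: "\<exists>i\<in>{1..l}. \<exists>j\<in>{1..m i}. nbhd E {v} ((2 * l - 1) * d) \<subseteq> S i j"
    if v: "v \<in> {1..n}" for v
  proof -
    obtain i where i: "i \<in> {1..l}" "\<And>u. u \<in> nbhd E {v} (2 * l * d) \<Longrightarrow> f i u = f i v"
      using padded[OF v] by blast
    have "f i v \<in> h i ` {1..m i}"
      using v by (simp only: bij_betw_imp_surj_on[OF h] imageI)
    then obtain j where j: "j \<in> {1..m i}" "h i j = f i v"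
      by (metis imageE)
    \<comment> \<open>The subtraction does not truncate, since \<open>i\<close> in
      \<open>{1..l}\<close> forces \<open>l\<close> to be positive.\<close>
    have rad: "(2 * l - 1) * d + d = 2 * l * d"
      using i(1) by (cases l) auto
    have in_cell: "x \<in> cell i j" if "x \<in> nbhd E {v} (2 * l * d)" for x
      using i(2)[OF that] j(2) that subsetD[OF nbhd_singleton_subset[OF v E] that]
      by (simp add: cell_def)
    have "u \<in> S i j" if u: "u \<in> nbhd E {v} ((2 * l - 1) * d)" for u
    proof -
      have "nbhd E {u} d \<subseteq> cell i j"
      proof
        fix x assume "x \<in> nbhd E {u} d"
        from nbhd_trans[OF u this] show "x \<in> cell i j"
          unfolding rad by (rule in_cell)
      qed
      moreover have "u \<in> {1..n}"
        using subsetD[OF nbhd_singleton_subset[OF v E] u] .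
      ultimately show ?thesis
        by (simp add: S_def)
    qed
    then show ?thesis
      using i(1) j(1) by blast
  qed
  have "covering_scheme n E l c d m S"
    unfolding covering_scheme_def
  proof (intro conjI ballI)
    show "S i j \<subseteq> {1..n}" for i j
      by (auto simp: S_def)
  qed (rule card_S disj cover, assumption?)+
  then show ?thesis
    by blast
qed

text \<open>An edge moves each coordinate by at most one, so a graph ball lies in a coordinate box
  of the same radius.\<close>

lemma lattice_walk_coordinate:
  assumes "(v, u) \<in> lattice_edges k n pos ^^ t" "i < k"
  shows "pos u i \<le> pos v i + t \<and> pos v i \<le> pos u i + t"
  using assms(1)
proof (induction t arbitrary: u)
  case (Suc t)
  then obtain x where x: "(v, x) \<in> lattice_edges k n pos ^^ t" "(x, u) \<in> lattice_edges k n pos"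
    by auto
  have "pos u i \<le> pos x i + 1 \<and> pos x i \<le> pos u i + 1"
    using x(2) \<open>i < k\<close> by (force simp: lattice_edges_def nearest_neighbors_def)
  then show ?case
    using Suc.IH[OF x(1)] by linarith
qed simp

text \<open>For positive \<open>P\<close>, the hypothesis puts \<open>x\<close> at offset at least
  \<open>q\<close> and below \<open>P - q\<close> in its block of length \<open>P\<close>, so a move
  by at most \<open>q\<close> cannot leave the block. Adding \<open>q\<close> merges the two sides
  of a cut into one residue window.\<close>

lemma div_eq_of_far_from_cut:
  fixes x y q r P :: nat
  assumes "2 * q \<le> (x + q) mod P" "y \<le> x + q" "x \<le> y + q"
  shows "y div P = x div P"
proof (cases "P = 0")
  case False
  define a b where "a = (x + q) div P" and "b = (x + q) mod P"
  have xq: "x + q = a * P + b"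
    by (simp add: a_def b_def)
  have "b < P"
    using False by (simp add: b_def)
  have "z div P = a" if "x \<le> z + q" "z \<le> x + q" for z
  proof (rule div_nat_eqI)
    show "P * a \<le> z" "z < P * Suc a"
      using that xq \<open>b < P\<close> assms(1) by (auto simp: b_def[symmetric] algebra_simps)
  qed
  then show ?thesis
    using assms(2,3) by simp
qed simp

text \<open>If \<open>i < j\<close>, adding \<open>(j - i) * w\<close> to a residue below
  \<open>w\<close> lands between \<open>w\<close> and \<open>l * w\<close>: beyond the window,
  without wrapping around.\<close>

lemma shifted_windows_disjoint:
  fixes y w i j l :: nat
  assumes "(y + i * w) mod (l * w) < w" "(y + j * w) mod (l * w) < w" "i < l" "j < l"
  shows "i = j"
proof -
  have False if ij: "i < j" and j: "j < l"
    and lt: "(y + i * w) mod (l * w) < w" "(y + j * w) mod (l * w) < w" for i j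
  proof -
    define r where "r = (y + i * w) mod (l * w)"
    have "y + j * w = (y + i * w) + (j - i) * w"
      using ij by (simp add: diff_mult_distrib)
    then have "(y + j * w) mod (l * w) = (r + (j - i) * w) mod (l * w)"
      by (simp only: r_def mod_add_left_eq)
    moreover have "r + (j - i) * w < l * w"
    proof -
      have "r + (j - i) * w < (1 + (j - i)) * w"
        using lt(1) by (simp add: r_def)
      also have "\<dots> \<le> l * w"
        using ij j by (intro mult_le_mono) auto
      finally show ?thesis .
    qed
    moreover have "w \<le> (j - i) * w"
      using ij by (simp add: Suc_le_eq)
    ultimately show False
      using lt(2) by simp
  qed
  then show ?thesis
    using assms by (metis linorder_neqE_nat)
qed

theorem theorem3:
  fixes k n d :: nat and N :: "nat \<Rightarrow> nat" and pos :: "nat \<Rightarrow> nat \<Rightarrow> nat"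
  assumes "lattice_labelling k N n pos" and "d > 0"
  shows "\<exists>c m S. covering_scheme n (lattice_edges k n pos) (k + 1) c d m S \<and>
           c \<le> ((8 * k ^ 2 + 14 * k + 2) * d) ^ k"
proof -
  \<comment> \<open>\<open>q\<close> is the padding \<open>2 * l * d\<close> for
    \<open>l = k + 1\<close>; a window reaches \<open>q\<close> to both sides of a cut, hence
    \<open>w = 2 * q\<close>.\<close>
  define q where "q = 2 * (k + 1) * d"
  define w where "w = 2 * q"
  define P where "P = (k + 1) * w"
  have "P > 0"
    using \<open>d > 0\<close> by (simp add: P_def w_def q_def)
  \<comment> \<open>\<open>f i v\<close> is the index vector of the cube containing
    \<open>v\<close>; colours start at 1, shifts at 0.\<close>
  define f where "f i v = (\<lambda>t\<in>{..<k}. (pos v t + (i - 1) * w) div P)" for i v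
  have pos: "inj_on pos {1..n}" "\<And>v. v \<in> {1..n} \<Longrightarrow> pos v \<in> grid k N"
    using assms(1) by (auto simp: lattice_labelling_def bij_betw_def)
  have cells: "card {v \<in> {1..n}. f i v = a} \<le> P ^ k" for i a
  proof -
    \<comment> \<open>The position inside the cube: together with the cube index it determines every
      coordinate, so a cell embeds into a box of side \<open>P\<close>.\<close>
    define g where "g v = (\<lambda>t\<in>{..<k}. (pos v t + (i - 1) * w) mod P)" for v
    let ?cell = "{v \<in> {1..n}. f i v = a}"
    have "inj_on g ?cell"
    proof (rule inj_onI)
      fix u v assume uv: "u \<in> ?cell" "v \<in> ?cell" "g u = g v"
      have "pos u t = pos v t" if "t < k" for t
      proof -
        have "f i u t = f i v t" "g u t = g v t"
          using uv by auto
        then have "(pos u t + (i - 1) * w) div P = (pos v t + (i - 1) * w) div P"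
          "(pos u t + (i - 1) * w) mod P = (pos v t + (i - 1) * w) mod P"
          using that by (simp_all add: f_def g_def)
        then show ?thesis
          by (metis div_mult_mod_eq add_right_cancel)
      qed
      moreover have "pos u \<in> extensional {..<k}" "pos v \<in> extensional {..<k}"
        using uv pos(2) by (auto simp: grid_def PiE_def)
      ultimately have "pos u = pos v"
        by (intro extensionalityI) auto
      then show "u = v"
        using uv pos(1) by (auto dest: inj_onD)
    qed
    moreover have "g ` ?cell \<subseteq> (\<Pi>\<^sub>E t\<in>{..<k}. {..<P})"
      using \<open>P > 0\<close> by (auto simp: g_def split: if_splits)
    ultimately have "card ?cell \<le> card (\<Pi>\<^sub>E t\<in>{..<k}. {..<P})"
      by (intro card_inj_on_le[of g]) (auto intro: finite_PiE)
    then show ?thesis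
      by (simp add: card_PiE)
  qed
  have padded: "\<exists>i\<in>{1..k + 1}. \<forall>u\<in>nbhd (lattice_edges k n pos) {v} (2 * (k + 1) * d). f i u = f i v"
    for v
  proof -
    define bad where "bad t i \<longleftrightarrow> (pos v t + q + i * w) mod P < w" for t i
    have "\<exists>i<k + 1. \<forall>t<k. \<not> bad t i"
    proof (rule ccontr)
      assume "\<not> ?thesis"
      then have "\<forall>i\<in>{..<k + 1}. \<exists>t. t < k \<and> bad t i"
        by blast
      then obtain \<tau> where "\<forall>i\<in>{..<k + 1}. \<tau> i < k \<and> bad (\<tau> i) i"
        by (rule bchoice[THEN exE])
      then have \<tau>: "\<tau> i < k" "bad (\<tau> i) i" if "i < k + 1" for i
        using that by auto
      \<comment> \<open>Pigeonhole: an axis is bad for at most one colour, so \<open>k + 1\<close>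
        colours would need \<open>k + 1\<close> axes.\<close>
      have "inj_on \<tau> {..<k + 1}"
      proof (rule inj_onI)
        fix i j assume ij: "i \<in> {..<k + 1}" "j \<in> {..<k + 1}" "\<tau> i = \<tau> j"
        then have "bad (\<tau> i) i" "bad (\<tau> i) j"
          using \<tau>[of i] \<tau>[of j] by auto
        then show "i = j"
          using ij unfolding bad_def P_def by (intro shifted_windows_disjoint) auto
      qed
      then have "card {..<k + 1} \<le> card {..<k}"
        using \<tau> by (intro card_inj_on_le[of \<tau>]) auto
      then show False
        by simp
    qed
    then obtain i where i: "i < k + 1" "\<And>t. t < k \<Longrightarrow> \<not> bad t i"
      by blast
    have "f (i + 1) u = f (i + 1) v" if u: "u \<in> nbhd (lattice_edges k n pos) {v} q" for u
    proof -
      have "(pos u t + i * w) div P = (pos v t + i * w) div P" if t: "t < k" for t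
      proof (rule div_eq_of_far_from_cut)
        obtain s where s: "s \<le> q" "(v, u) \<in> lattice_edges k n pos ^^ s"
          using u by (auto simp: mem_nbhd_singleton)
        show "pos u t + i * w \<le> pos v t + i * w + q" "pos v t + i * w \<le> pos u t + i * w + q"
          using lattice_walk_coordinate[OF s(2) t] s(1) by linarith+
        show "2 * q \<le> (pos v t + i * w + q) mod P"
          using i(2)[OF t] by (simp add: bad_def w_def ac_simps)
      qed
      then show ?thesis
        by (auto simp: f_def restrict_def)
    qed
    then show ?thesis
      using i(1) unfolding q_def by (intro bexI[of _ "i + 1"]) auto
  qed
  have "lattice_edges k n pos \<subseteq> {1..n} \<times> {1..n}"
    by (auto simp: lattice_edges_def)
  then have "\<exists>m S. covering_scheme n (lattice_edges k n pos) (k + 1) (P ^ k) d m S"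
    by (rule covering_scheme_of_padded_partitions[where f = f]) (rule cells padded)+
  then obtain m S where "covering_scheme n (lattice_edges k n pos) (k + 1) (P ^ k) d m S"
    by blast
  moreover have "P ^ k \<le> ((8 * k ^ 2 + 14 * k + 2) * d) ^ k"
  \<comment> \<open>For \<open>k = 0\<close> the bases compare the wrong way, \<open>4 * d\<close>
    against \<open>2 * d\<close>, but both powers are 1.\<close>
  proof (cases "k = 0")
    case False
    have "P = (4 * k ^ 2 + 8 * k + 4) * d"
      by (simp add: P_def w_def q_def power2_eq_square algebra_simps)
    also have "\<dots> \<le> (8 * k ^ 2 + 14 * k + 2) * d"
      using False by (intro mult_le_mono1) auto
    finally show ?thesis
      by (rule power_mono) simp
  qed simp
  ultimately show ?thesis
    by blast
qed

end
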